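(* Let $d\ge 1$ and let $p:\mathbb{R}^d\to(0,\infty)$ be a probability density function (with respect to Lebesgue measure). Assume that: (i) there exists a function $\widetilde p:[0,\infty)\to(0,\infty)$ of class $C^1$ with $\widetilde p^{\,\prime}(x)<0$ for all $x\ge 0$ such that $p(x)=\widetilde p(\|x\|^2)$ for all $x\in\mathbb{R}^d$; (ii) $f:(0,\infty)\to\mathbb{R}$ is of class $C^2$, $f(1)=0$, and $f''(x)>0$ for all $x>0$; (iii) for every $t\in\mathbb{R}^d$, $$\int_{\mathbb{R}^d}\left|f\left(\frac{\widetilde p(\|x+t\|^2)}{\widetilde p(\|x\|^2)}\right)\right|\,\widetilde p(\|x\|^2)\,dx<+\infty;$$ (iv) for every compact subset $K$ of $\mathbb{R}^d$, $$\int_{\mathbb{R}^d}\sup_{t\in K}\left|f'\left(\frac{\widetilde p(\|y\|^2)}{\widetilde p(\|y+t\|^2)}\right)\right|\,\left|\widetilde p^{\,\prime}(\|y\|^2)\right|\,\|y\|\,dy<+\infty.$$ Then there exists a strictly increasing and differentiable function $h_f:[0,\infty)\to\mathbb{R}$ such that, for every symmetric positive-definite $d\times d$ real matrix $\Sigma$, $$I_f\left(p_{\mu_1,\Sigma}:p_{\mu_2,\Sigma}\right)=h_f\left(\Delta_\Sigma^2(\mu_1,\mu_2)\right)\qquad\text{for all }\mu_1,\mu_2\in\mathbb{R}^d.$$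
   Context: $\|\cdot\|$ denotes the Euclidean norm on $\mathbb{R}^d$. For $\mu\in\mathbb{R}^d$ and a symmetric positive-definite $d\times d$ real matrix $\Sigma$, with $\Sigma^{1/2}$ its unique symmetric positive-definite square root and $\Sigma^{-1/2}$ the inverse of $\Sigma^{1/2}$, the density of the location-scale family generated by the standard density $p$ is $$p_{\mu,\Sigma}(x):=\frac{1}{\sqrt{\det(\Sigma)}}\,p\left(\Sigma^{-1/2}(x-\mu)\right),\quad x\in\mathbb{R}^d.$$ The $f$-divergence is $$I_f(p_{\mu_1,\Sigma}:p_{\mu_2,\Sigma}):=\int_{\mathbb{R}^d}f\left(\frac{p_{\mu_2,\Sigma}(x)}{p_{\mu_1,\Sigma}(x)}\right)p_{\mu_1,\Sigma}(x)\,dx.$$ The squared Mahalanobis distance is $$\Delta_\Sigma^2(\mu_1,\mu_2):=(\mu_2-\mu_1)^\top\Sigma^{-1}(\mu_2-\mu_1).$$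
   Formalization: Differentiability of h_f is asserted only on (0,∞), with continuity on [0,∞): under (i)–(iv) the one-sided derivative at 0 can be infinite (e.g. d=1, f=-log, p with infinite Fisher information), so differentiability at 0 fails in general. *)

theory Defs
  imports "HOL-Analysis.Analysis"
begin

definition sym_pos_def :: "real^'n^'n \<Rightarrow> bool" where
  "sym_pos_def A \<longleftrightarrow> transpose A = A \<and> (\<forall>x. x \<noteq> 0 \<longrightarrow> x \<bullet> (A *v x) > 0)"

(* Meaningful only for symmetric positive-definite A, where the root exists and is unique. *)
definition spd_sqrt :: "real^'n^'n \<Rightarrow> real^'n^'n" where
  "spd_sqrt A = (THE S. sym_pos_def S \<and> S ** S = A)"

definition loc_scale_density ::
    "(real^'n \<Rightarrow> real) \<Rightarrow> real^'n \<Rightarrow> real^'n^'n \<Rightarrow> real^'n \<Rightarrow> real" where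
  "loc_scale_density p \<mu> \<Sigma> x =
     1 / sqrt (det \<Sigma>) * p (matrix_inv (spd_sqrt \<Sigma>) *v (x - \<mu>))"

(* The first density is the reference density: I_f(p : q) integrates f (q/p) against p. *)
definition f_div_integrand ::
    "(real \<Rightarrow> real) \<Rightarrow> (real^'n \<Rightarrow> real) \<Rightarrow> (real^'n \<Rightarrow> real) \<Rightarrow> real^'n \<Rightarrow> real" where
  "f_div_integrand f p q x = f (q x / p x) * p x"

definition f_divergence ::
    "(real \<Rightarrow> real) \<Rightarrow> (real^'n \<Rightarrow> real) \<Rightarrow> (real^'n \<Rightarrow> real) \<Rightarrow> real" where
  "f_divergence f p q = (LINT x|lborel. f_div_integrand f p q x)"

definition mahalanobis_sq :: "real^'n^'n \<Rightarrow> real^'n \<Rightarrow> real^'n \<Rightarrow> real" where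
  "mahalanobis_sq \<Sigma> \<mu>1 \<mu>2 = (\<mu>2 - \<mu>1) \<bullet> (matrix_inv \<Sigma> *v (\<mu>2 - \<mu>1))"

end

theory Submission
  imports Defs
begin

text \<open>
  Substituting \<open>x = \<mu>1 + \<Sigma>\<^sup>1\<^sup>/\<^sup>2 y\<close> turns the divergence of two members of the family into
  \<open>J s = \<integral> f (p (y - s) / p y) p y dy\<close> with \<open>s = \<Sigma>\<^sup>-\<^sup>1\<^sup>/\<^sup>2 (\<mu>2 - \<mu>1)\<close>, whose norm is the Mahalanobis
  distance. Since \<open>p\<close> is radial and Lebesgue measure is invariant under orthogonal maps, \<open>J s\<close>
  depends on \<open>norm s\<close> only. Hence \<open>h r = J (sqrt r e)\<close>, for any fixed unit vector \<open>e\<close>, is the function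
  sought, and what has to be shown is that \<open>t \<mapsto> J (t e)\<close> is differentiable and strictly increasing.

  The expected derivative at \<open>t\<close> is, after the translation \<open>y \<mapsto> y + t e\<close>,
  \<open>G t = \<integral> f' (p y / p (y + t e)) (- 2 pt' (norm y ^ 2)) (y \<bullet> e) dy\<close>. The domination hypothesis
  bounds the integrand only in this translated form, uniformly for \<open>t\<close> in a bounded set; it does not
  bound the untranslated derivative, so it does not justify differentiation under the
  integral sign. Instead the pointwise increment is written as an integral over \<open>t\<close>, the order of
  integration is exchanged, and the inner integral is translated for each \<open>t\<close> separately. This gives
  \<open>J (b e) - J 0 = \<integral>\<^sub>0\<^sup>b G t dt\<close> (\<open>shift_divergence_increment\<close>); as \<open>G\<close> is continuous by dominated
  convergence (\<open>continuous_on_slope\<close>), the fundamental theorem of calculus applies.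

  For \<open>G t > 0\<close> (\<open>slope_pos\<close>), averaging the integrand over \<open>y\<close> and \<open>- y\<close> produces the difference
  \<open>f' (p y / p (y + t e)) - f' (p y / p (y - t e))\<close> times \<open>y \<bullet> e\<close>. For \<open>t > 0\<close> the point \<open>y + t e\<close> is further
  from the origin than \<open>y - t e\<close> exactly if \<open>y \<bullet> e > 0\<close>; as \<open>p\<close> decreases with the norm and \<open>f'\<close> increases,
  the product is positive off the hyperplane \<open>y \<bullet> e = 0\<close>.

  The square root of \<open>\<Sigma>\<close> comes from the spectral theorem for symmetric matrices. Its diagonal form also
  reduces the change of variables to the orthogonal and the diagonal case.
\<close>

section \<open>Spectral theorem for symmetric matrices\<close>

text \<open>
  The quadratic form \<open>x \<bullet> f x\<close> attains its maximum on the compact unit sphere of \<open>V\<close>, and a maximizer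
  is an eigenvector.
\<close>

lemma self_adjoint_eigenvector_exists:
  fixes f :: "'a::euclidean_space \<Rightarrow> 'a"
  assumes "linear f" and adj: "\<And>x y. f x \<bullet> y = x \<bullet> f y"
    and V: "subspace V" "f ` V \<subseteq> V" "V \<noteq> {0}"
  obtains v l where "v \<in> V" "norm v = 1" "f v = l *\<^sub>R v"
proof -
  interpret linear f by fact
  let ?S = "V \<inter> sphere 0 1"
  have "compact ?S"
    using closed_Int_compact[OF closed_subspace[OF V(1)] compact_sphere] .
  moreover obtain x where x: "x \<in> V" "x \<noteq> 0"
    using V subspace_0 by blast
  then have "x /\<^sub>R norm x \<in> ?S"
    using V(1) by (simp add: subspace_scale)
  moreover have "continuous_on ?S (\<lambda>x. x \<bullet> f x)"
    by (intro continuous_intros linear_continuous_on linear_linear[THEN iffD2] \<open>linear f\<close>)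
  ultimately obtain v where v: "v \<in> ?S" and vmax: "\<And>x. x \<in> ?S \<Longrightarrow> x \<bullet> f x \<le> v \<bullet> f v"
    by (metis continuous_attains_sup empty_iff)
  define l where "l = v \<bullet> f v"
  have vv: "v \<bullet> v = 1" and "v \<in> V"
    using v by (auto simp: norm_eq_1)
  \<comment> \<open>Homogeneity extends the maximality on the unit sphere to an inequality on all of \<^term>\<open>V\<close>.\<close>
  have q: "x \<bullet> f x \<le> l * (x \<bullet> x)" if "x \<in> V" for x
  proof (cases "x = 0")
    case False
    then have "x /\<^sub>R norm x \<in> ?S"
      using V(1) that by (simp add: subspace_scale)
    from vmax[OF this] False show ?thesis
      by (simp add: l_def[symmetric] scaleR field_simps power2_norm_eq_inner[symmetric] power2_eq_square)
  qed (simp add: zero)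
  define w where "w = f v - l *\<^sub>R v"
  have "w \<in> V"
    unfolding w_def using V \<open>v \<in> V\<close> by (intro subspace_diff subspace_scale) auto
  \<comment> \<open>The form \<^term>\<open>l * (x \<bullet> x) - x \<bullet> f x\<close> is nonnegative on \<^term>\<open>V\<close> and vanishes at \<^term>\<open>v\<close>;
    hence its first-order term in the direction of the residual \<^term>\<open>w\<close> must vanish.\<close>
  have ineq: "2 * t * (w \<bullet> w) \<le> t\<^sup>2 * (l * (w \<bullet> w) - w \<bullet> f w)" for t
  proof -
    have "v + t *\<^sub>R w \<in> V"
      using V(1) \<open>v \<in> V\<close> \<open>w \<in> V\<close> by (intro subspace_add subspace_scale)
    from q[OF this]
    have "(v + t *\<^sub>R w) \<bullet> f (v + t *\<^sub>R w) \<le> l * ((v + t *\<^sub>R w) \<bullet> (v + t *\<^sub>R w))" .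
    also have "(v + t *\<^sub>R w) \<bullet> f (v + t *\<^sub>R w) = l + 2 * t * (w \<bullet> f v) + t\<^sup>2 * (w \<bullet> f w)"
      using adj[of v w]
      by (simp add: add scaleR inner_simps l_def algebra_simps power2_eq_square inner_commute)
    also have "(v + t *\<^sub>R w) \<bullet> (v + t *\<^sub>R w) = 1 + 2 * t * (w \<bullet> v) + t\<^sup>2 * (w \<bullet> w)"
      by (simp add: inner_simps vv algebra_simps power2_eq_square inner_commute)
    also have "w \<bullet> f v = w \<bullet> w + l * (w \<bullet> v)"
      by (simp add: w_def inner_simps algebra_simps)
    finally show ?thesis
      by (simp add: algebra_simps)
  qed
  \<comment> \<open>The step size \<^term>\<open>(w \<bullet> w) / c\<close> is small enough for the first-order term to dominate.\<close>
  define c where "c = \<bar>l * (w \<bullet> w) - w \<bullet> f w\<bar> + 1"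
  have "c > 0" by (simp add: c_def add_nonneg_pos)
  have "w \<bullet> w = 0"
  proof -
    have "2 * ((w \<bullet> w) / c) * (w \<bullet> w) \<le> ((w \<bullet> w) / c)\<^sup>2 * (l * (w \<bullet> w) - w \<bullet> f w)" by (rule ineq)
    also have "\<dots> \<le> ((w \<bullet> w) / c)\<^sup>2 * c"
      by (intro mult_left_mono) (auto simp: c_def)
    finally have "2 * (w \<bullet> w)\<^sup>2 \<le> (w \<bullet> w)\<^sup>2"
      using \<open>c > 0\<close> by (simp add: field_simps power2_eq_square)
    then have "(w \<bullet> w)\<^sup>2 \<le> 0" by simp
    then show ?thesis by (simp only: power2_less_eq_zero_iff)
  qed
  then have "f v = l *\<^sub>R v"
    by (simp add: w_def)
  with v \<open>v \<in> V\<close> that show thesis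
    by (simp)
qed

text \<open>
  Split off one eigenvector \<open>v\<close> and recurse: self-adjointness makes the orthogonal complement of
  \<open>v\<close> in \<open>V\<close> invariant. Working with invariant subspaces instead of whole types is what makes the
  induction on the dimension possible.
\<close>

lemma self_adjoint_orthonormal_eigenbasis:
  fixes f :: "'a::euclidean_space \<Rightarrow> 'a"
  assumes "linear f" and adj: "\<And>x y. f x \<bullet> y = x \<bullet> f y"
    and "subspace V" "f ` V \<subseteq> V"
  shows "\<exists>B\<subseteq>V. pairwise orthogonal B \<and> (\<forall>b\<in>B. norm b = 1 \<and> (\<exists>l. f b = l *\<^sub>R b)) \<and> V \<subseteq> span B"
  using assms(3,4)
proof (induction "dim V" arbitrary: V rule: less_induct)
  case less
  show ?case
  proof (cases "V = {0}")
    case True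
    then show ?thesis
      by (intro exI[of _ "{}"]) auto
  next
    case False
    then obtain v l where v: "v \<in> V" "norm v = 1" "f v = l *\<^sub>R v"
      using self_adjoint_eigenvector_exists[OF assms(1,2) less.prems] by blast
    let ?W = "{x \<in> V. v \<bullet> x = 0}"
    have W: "subspace ?W"
      using less.prems(1) by (auto simp: subspace_def inner_simps)
    have "v \<bullet> f x = 0" if "v \<bullet> x = 0" for x
      using adj[of v x] v(3) that by simp
    then have fW: "f ` ?W \<subseteq> ?W"
      using less.prems(2) by blast
    have "v \<notin> ?W"
      using v(2) by auto
    then have "?W \<subset> V"
      using v(1) by blast
    then have "dim ?W < dim V"
      using W less.prems(1) by (metis dim_psubset span_eq_iff)
    from less.hyps[OF this W fW] obtain B where B: "B \<subseteq> ?W" "pairwise orthogonal B"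
      "\<forall>b\<in>B. norm b = 1 \<and> (\<exists>l. f b = l *\<^sub>R b)" "?W \<subseteq> span B"
      by blast
    have "V \<subseteq> span (insert v B)"
    proof
      fix x assume "x \<in> V"
      then have "x - (v \<bullet> x) *\<^sub>R v \<in> ?W"
        using v less.prems(1) by (auto simp: inner_simps norm_eq_1 intro: subspace_diff subspace_scale)
      then show "x \<in> span (insert v B)"
        using B(4) span_breakdown_eq by blast
    qed
    moreover have "pairwise orthogonal (insert v B)"
      using B(1,2) by (auto simp: pairwise_insert orthogonal_def inner_commute)
    ultimately show ?thesis
      using B v by (intro exI[of _ "insert v B"]) auto
  qed
qed

lemma symmetric_matrix_self_adjoint:
  fixes A :: "real^'n^'n"
  assumes "transpose A = A"
  shows "(A *v x) \<bullet> y = x \<bullet> (A *v y)"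
  by (metis assms dot_lmul_matrix transpose_matrix_vector)

definition diagonal_matrix :: "('n \<Rightarrow> real) \<Rightarrow> real^'n^'n" where
  "diagonal_matrix l = (\<chi> i j. if i = j then l i else 0)"

lemma diagonal_matrix_vector_mult: "(diagonal_matrix l *v x) $ i = l i * x $ i"
  by (simp add: diagonal_matrix_def matrix_vector_mult_def if_distrib[where f="\<lambda>a. a * _"] cong: if_cong)

lemma diagonal_matrix_mult: "diagonal_matrix k ** diagonal_matrix l = diagonal_matrix (\<lambda>i. k i * l i)"
  by (auto simp: diagonal_matrix_def matrix_matrix_mult_def vec_eq_iff if_distrib[where f="\<lambda>a. a * _"] cong: if_cong)

lemma transpose_diagonal_matrix: "transpose (diagonal_matrix l) = diagonal_matrix l"
  by (auto simp: diagonal_matrix_def transpose_def vec_eq_iff)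

lemma symmetric_matrix_diagonalization:
  fixes A :: "real^'n^'n"
  assumes A: "transpose A = A"
  obtains Q l where "orthogonal_matrix Q" "A = Q ** diagonal_matrix l ** transpose Q"
    "\<And>i. A *v column i Q = l i *\<^sub>R column i Q"
proof -
  obtain B where B: "pairwise orthogonal B" "UNIV \<subseteq> span B"
    "\<And>b. b \<in> B \<Longrightarrow> norm b = 1" "\<And>b. b \<in> B \<Longrightarrow> \<exists>l. A *v b = l *\<^sub>R b"
    using self_adjoint_orthonormal_eigenbasis[of "(*v) A" UNIV]
      symmetric_matrix_self_adjoint[OF A] by auto
  have "0 \<notin> B"
    using B(3)[of 0] by auto
  then have "independent B"
    using B by (intro pairwise_orthogonal_independent) auto
  then have "finite B" "card B = CARD('n)"
    using B(2) dim_unique[of B UNIV "card B"] independent_imp_finite by auto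
  then obtain b :: "'n \<Rightarrow> real^'n" where b: "bij_betw b UNIV B"
    using finite_same_card_bij[of "UNIV :: 'n set" B] by auto
  then have bB: "b i \<in> B" for i
    by (auto simp: bij_betw_def)
  have "\<forall>i. \<exists>l. A *v b i = l *\<^sub>R b i"
    using B(4) bB by blast
  then obtain l where l: "\<And>i. A *v b i = l i *\<^sub>R b i"
    unfolding choice_iff by blast
  define Q :: "real^'n^'n" where "Q = (\<chi> i j. b j $ i)"
  have col: "column i Q = b i" for i
    by (simp add: Q_def column_def)
  have Q: "orthogonal_matrix Q"
    unfolding orthogonal_matrix_orthonormal_columns col
    using b bB B(1,3) unfolding pairwise_def bij_betw_def inj_on_def by (metis UNIV_I)
  have "A ** Q = Q ** diagonal_matrix l"
    using l by (simp add: vec_eq_iff matrix_matrix_mult_def matrix_vector_mult_def Q_def diagonal_matrix_def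
        if_distrib[where f="\<lambda>a. _ * a"] mult.commute cong: if_cong)
  then have "A = Q ** diagonal_matrix l ** transpose Q"
    using Q by (metis matrix_mul_assoc matrix_mul_rid orthogonal_matrix_def)
  with Q show thesis
    using l by (intro that[of Q l]) (simp_all add: col)
qed

lemma sym_pos_def_sqrt_exists:
  fixes A :: "real^'n^'n"
  assumes A: "sym_pos_def A"
  shows "\<exists>Q k. orthogonal_matrix Q \<and> (\<forall>i. k i > 0) \<and>
    (let S = Q ** diagonal_matrix k ** transpose Q in sym_pos_def S \<and> S ** S = A)"
proof -
  obtain Q l where Q: "orthogonal_matrix Q" and AQ: "A = Q ** diagonal_matrix l ** transpose Q"
    and eig: "\<And>i. A *v column i Q = l i *\<^sub>R column i Q"
    using A symmetric_matrix_diagonalization unfolding sym_pos_def_def by blast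
  have l: "l i > 0" for i
  proof -
    have "norm (column i Q) = 1"
      using Q unfolding orthogonal_matrix_orthonormal_columns by blast
    then have "column i Q \<noteq> 0" "column i Q \<bullet> column i Q = 1"
      by (auto simp: norm_eq_1)
    then show ?thesis
      using A eig[of i] unfolding sym_pos_def_def by (metis inner_scaleR_right mult.right_neutral)
  qed
  define k where "k i = sqrt (l i)" for i
  define S where "S = Q ** diagonal_matrix k ** transpose Q"
  have k: "k i > 0" "k i * k i = l i" for i
    using l[of i] by (auto simp: k_def)
  then have kk: "(\<lambda>i. k i * k i) = l"
    by auto
  have QtQ: "transpose Q ** Q = mat 1" "Q ** transpose Q = mat 1"
    using Q by (auto simp: orthogonal_matrix_def)
  have "transpose S = S"
    by (simp add: S_def matrix_transpose_mul transpose_diagonal_matrix matrix_mul_assoc)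
  moreover have "S ** S = Q ** diagonal_matrix k ** (transpose Q ** Q) ** diagonal_matrix k ** transpose Q"
    by (simp add: S_def matrix_mul_assoc)
  then have "S ** S = A"
    by (simp add: QtQ AQ diagonal_matrix_mult kk flip: matrix_mul_assoc)
  moreover have "x \<bullet> (S *v x) > 0" if "x \<noteq> 0" for x
  proof -
    define y where "y = transpose Q *v x"
    have "Q *v y = x"
      using QtQ(2) by (metis y_def matrix_vector_mul_assoc matrix_vector_mul_lid)
    then have "y \<noteq> 0"
      using that by auto
    have "x \<bullet> (S *v x) = y \<bullet> (diagonal_matrix k *v y)"
      by (simp add: S_def y_def dot_lmul_matrix transpose_matrix_vector flip: matrix_vector_mul_assoc)
    also have "\<dots> = (\<Sum>i\<in>UNIV. k i * (y $ i)\<^sup>2)"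
      by (simp add: inner_vec_def diagonal_matrix_vector_mult power2_eq_square mult_ac)
    also have "\<dots> > 0"
    proof -
      obtain i where "y $ i \<noteq> 0"
        using \<open>y \<noteq> 0\<close> by (auto simp: vec_eq_iff)
      then show ?thesis
        using k(1) by (intro sum_pos2[of UNIV i]) (auto simp: less_imp_le)
    qed
    finally show ?thesis .
  qed
  ultimately show ?thesis
    using Q k unfolding sym_pos_def_def Let_def S_def by blast
qed

text \<open>
  For two positive definite roots \<open>S\<close> and \<open>T\<close> of the same matrix, \<open>D = S - T\<close> satisfies
  \<open>S D + D T = S S - T T = 0\<close>. Testing this identity on an eigenvector \<open>v\<close> of \<open>D\<close> with eigenvalue \<open>l\<close> gives
  \<open>l (v \<bullet> S v + v \<bullet> T v) = 0\<close>, so \<open>D\<close> has no eigenvalue except \<open>0\<close>.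
\<close>

lemma sym_pos_def_sqrt_unique:
  fixes S T :: "real^'n^'n"
  assumes S: "sym_pos_def S" and T: "sym_pos_def T" and ST: "S ** S = T ** T"
  shows "S = T"
proof -
  define D where "D = S - T"
  have symS: "transpose S = S" and symT: "transpose T = T"
    using S T by (auto simp: sym_pos_def_def)
  have "transpose D = D"
    using symS symT by (simp add: D_def transpose_def vec_eq_iff)
  then obtain Q l where Q: "orthogonal_matrix Q" and DQ: "D = Q ** diagonal_matrix l ** transpose Q"
    and eig: "\<And>i. D *v column i Q = l i *\<^sub>R column i Q"
    using symmetric_matrix_diagonalization by blast
  have "l i = 0" for i
  proof -
    define v where "v = column i Q"
    have "norm v = 1"
      using Q unfolding orthogonal_matrix_orthonormal_columns v_def by blast
    then have "v \<noteq> 0" by auto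
    have Dv: "D *v v = l i *\<^sub>R v"
      using eig v_def by simp
    have "S *v (D *v v) + D *v (T *v v) = S *v (S *v v) - T *v (T *v v)"
      by (simp add: D_def matrix_vector_mult_diff_rdistrib matrix_vector_mult_diff_distrib)
    also have "\<dots> = 0"
      by (simp add: matrix_vector_mul_assoc ST)
    finally have "v \<bullet> (S *v (D *v v) + D *v (T *v v)) = 0"
      by simp
    moreover have "v \<bullet> (D *v (T *v v)) = (D *v v) \<bullet> (T *v v)"
      by (rule symmetric_matrix_self_adjoint[OF \<open>transpose D = D\<close>, symmetric])
    ultimately have "l i * (v \<bullet> (S *v v) + v \<bullet> (T *v v)) = 0"
      by (simp add: Dv inner_simps matrix_vector_mult_scaleR algebra_simps)
    moreover have "v \<bullet> (S *v v) + v \<bullet> (T *v v) > 0"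
      using S T \<open>v \<noteq> 0\<close> by (simp add: sym_pos_def_def add_pos_pos)
    ultimately show ?thesis by simp
  qed
  then have "diagonal_matrix l = (0 :: real^'n^'n)"
    by (auto simp: vec_eq_iff diagonal_matrix_def)
  then have "D = 0"
    by (simp add: DQ)
  then show ?thesis
    by (simp add: D_def)
qed

text \<open>
  Existence and uniqueness together identify the definite description in \<^const>\<open>spd_sqrt\<close> with
  the root built from the spectral decomposition; the diagonal form is kept because the change of
  variables below relies on it.
\<close>

lemma spd_sqrt_diagonalization:
  fixes A :: "real^'n^'n"
  assumes A: "sym_pos_def A"
  obtains Q k where "orthogonal_matrix Q" "\<And>i. k i > 0"
    "spd_sqrt A = Q ** diagonal_matrix k ** transpose Q"
    "sym_pos_def (spd_sqrt A)" "spd_sqrt A ** spd_sqrt A = A"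
proof -
  obtain Q k where Q: "orthogonal_matrix Q" "\<And>i. k i > 0" and
    S: "sym_pos_def (Q ** diagonal_matrix k ** transpose Q)" 
    "(Q ** diagonal_matrix k ** transpose Q) ** (Q ** diagonal_matrix k ** transpose Q) = A"
    using sym_pos_def_sqrt_exists[OF A] unfolding Let_def by blast
  have "spd_sqrt A = Q ** diagonal_matrix k ** transpose Q"
    unfolding spd_sqrt_def
  proof (rule the_equality)
    fix T assume "sym_pos_def T \<and> T ** T = A"
    then show "T = Q ** diagonal_matrix k ** transpose Q"
      using S by (metis sym_pos_def_sqrt_unique)
  qed (use S in blast)
  with Q S show thesis
    by (intro that[of Q k]) simp_all
qed

lemma sym_pos_def_invertible:
  fixes A :: "real^'n^'n"
  assumes "sym_pos_def A"
  shows "invertible A"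
proof -
  have "\<forall>x. A *v x = 0 \<longrightarrow> x = 0"
    using assms unfolding sym_pos_def_def by (metis inner_zero_right less_irrefl)
  then show ?thesis
    by (simp add: invertible_left_inverse matrix_left_invertible_ker)
qed

lemma matrix_inv_mult:
  assumes "invertible A"
  shows "A ** matrix_inv A = mat 1" "matrix_inv A ** A = mat 1"
  using someI_ex[OF assms[unfolded invertible_def]] by (auto simp: matrix_inv_def)

lemma mahalanobis_sq_eq_norm:
  fixes \<Sigma> :: "real^'n^'n"
  assumes "sym_pos_def \<Sigma>"
  shows "mahalanobis_sq \<Sigma> \<mu>1 \<mu>2 = (norm (matrix_inv (spd_sqrt \<Sigma>) *v (\<mu>2 - \<mu>1)))\<^sup>2"
proof -
  define S where "S = spd_sqrt \<Sigma>"
  define R where "R = matrix_inv S"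
  have S: "sym_pos_def S" "S ** S = \<Sigma>"
    using spd_sqrt_diagonalization[OF assms] S_def by metis+
  have SR: "S ** R = mat 1" "R ** S = mat 1"
    using matrix_inv_mult sym_pos_def_invertible[OF S(1)] by (auto simp: R_def)
  have symR: "transpose R = R"
    using S(1) SR by (metis matrix_mul_assoc matrix_mul_lid matrix_mul_rid matrix_transpose_mul sym_pos_def_def transpose_mat)
  have "(R ** R) ** \<Sigma> = R ** (R ** S) ** S"
    by (simp add: S(2)[symmetric] matrix_mul_assoc)
  then have "(R ** R) ** \<Sigma> = mat 1"
    by (simp add: SR)
  moreover have "\<Sigma> ** matrix_inv \<Sigma> = mat 1"
    using matrix_inv_mult sym_pos_def_invertible[OF assms] by blast
  ultimately have "matrix_inv \<Sigma> = R ** R"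
    by (metis matrix_mul_assoc matrix_mul_lid matrix_mul_rid)
  then show ?thesis
    unfolding mahalanobis_sq_def S_def[symmetric] R_def[symmetric] power2_norm_eq_inner
    by (simp add: symmetric_matrix_self_adjoint[OF symR] flip: matrix_vector_mul_assoc)
qed

section \<open>Linear change of variables in Lebesgue integrals\<close>

lemma nn_integral_lborel_translate:
  fixes f :: "'a::euclidean_space \<Rightarrow> ennreal"
  assumes [measurable]: "f \<in> borel_measurable borel"
  shows "(\<integral>\<^sup>+x. f (x + t) \<partial>lborel) = (\<integral>\<^sup>+x. f x \<partial>lborel)"
proof -
  have "(\<integral>\<^sup>+x. f x \<partial>lborel) = (\<integral>\<^sup>+x. f x \<partial>distr lborel borel ((+) t))"
    by (simp add: lborel_distr_plus)
  also have "\<dots> = (\<integral>\<^sup>+x. f (x + t) \<partial>lborel)"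
    by (subst nn_integral_distr) (auto simp: add.commute)
  finally show ?thesis ..
qed

text \<open>
  Lebesgue measure and its image under \<open>T\<close> are both translation invariant, which forces them to be
  proportional; the unit ball, being fixed by \<open>T\<close>, shows that the factor is one. The proof carries out
  the usual uniqueness argument for Haar measure directly: the product of \<open>\<integral> f (T y)\<close> with the volume
  \<open>\<integral> g\<close> of the ball is transformed by Fubini and translations into \<open>\<integral> f\<close> times \<open>\<integral> g\<close>.
\<close>

lemma nn_integral_lborel_orthogonal_transformation:
  fixes f :: "'a::euclidean_space \<Rightarrow> ennreal" and T :: "'a \<Rightarrow> 'a"
  assumes T: "orthogonal_transformation T" and f[measurable]: "f \<in> borel_measurable borel"
  shows "(\<integral>\<^sup>+x. f (T x) \<partial>lborel) = (\<integral>\<^sup>+x. f x \<partial>lborel)"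
proof -
  define g where "g = (indicator (ball 0 1) :: 'a \<Rightarrow> ennreal)"
  have [measurable]: "g \<in> borel_measurable borel"
    unfolding g_def by (intro borel_measurable_indicator borel_open open_ball)
  have lin: "linear T" and "surj T" and normT: "\<And>x. norm (T x) = norm x"
    using orthogonal_transformation_surj[OF T] T by (auto simp: orthogonal_transformation)
  interpret linear T by fact
  have [measurable]: "T \<in> borel_measurable borel"
    by (intro borel_measurable_continuous_onI linear_continuous_on linear_linear[THEN iffD2] lin)
  let ?V = "\<integral>\<^sup>+x. g x \<partial>lborel"
  have "?V = emeasure lborel (ball (0::'a) 1)"
    by (simp add: g_def)
  moreover have "emeasure lborel (ball (0::'a) 1) \<noteq> 0" 
    using open_not_negligible[of "ball (0::'a) 1"]
    by (simp add: negligible_iff_emeasure0 emeasure_completion)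
  ultimately have V: "?V \<noteq> 0" "?V \<noteq> \<infinity>"
    using emeasure_lborel_ball_finite[of "0::'a" 1] by auto
  have shift: "(\<integral>\<^sup>+y. f (T y + x) \<partial>lborel) = (\<integral>\<^sup>+y. f (T y) \<partial>lborel)" for x
  proof -
    obtain z where "x = T z" using surjD[OF \<open>surj T\<close>, of x] by blast
    then show ?thesis
      using nn_integral_lborel_translate[of "\<lambda>y. f (T y)" z] by (simp add: add)
  qed
  have g_shift: "(\<integral>\<^sup>+y. g (x - T y) \<partial>lborel) = ?V" for x
  proof -
    obtain z where z: "x = T z" using surjD[OF \<open>surj T\<close>, of x] by blast
    have "g (x - T y) = g (y + (- z))" for y
      using normT[of "z - y"] by (simp add: g_def z diff norm_minus_commute indicator_def)
    then show ?thesis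
      using nn_integral_lborel_translate[of g "- z"] by simp
  qed
  have "?V * (\<integral>\<^sup>+y. f (T y) \<partial>lborel) = (\<integral>\<^sup>+x. \<integral>\<^sup>+y. g x * f (T y + x) \<partial>lborel \<partial>lborel)"
    by (simp add: nn_integral_cmult nn_integral_multc shift)
  also have "\<dots> = (\<integral>\<^sup>+y. \<integral>\<^sup>+x. g x * f (T y + x) \<partial>lborel \<partial>lborel)"
    by (rule lborel_pair.Fubini'[of "\<lambda>y x. g x * f (T y + x)"]) measurable
  also have "\<dots> = (\<integral>\<^sup>+y. \<integral>\<^sup>+x. g (x - T y) * f x \<partial>lborel \<partial>lborel)"
  proof (rule nn_integral_cong)
    fix y
    show "(\<integral>\<^sup>+x. g x * f (T y + x) \<partial>lborel) = (\<integral>\<^sup>+x. g (x - T y) * f x \<partial>lborel)"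
      using nn_integral_lborel_translate[of "\<lambda>x. g (x - T y) * f x" "T y"] by (simp add: add.commute)
  qed
  also have "\<dots> = (\<integral>\<^sup>+x. \<integral>\<^sup>+y. g (x - T y) * f x \<partial>lborel \<partial>lborel)"
    by (rule lborel_pair.Fubini'[of "\<lambda>x y. g (x - T y) * f x"]) measurable
  also have "\<dots> = ?V * (\<integral>\<^sup>+x. f x \<partial>lborel)"
    by (simp add: nn_integral_cmult nn_integral_multc g_shift)
  finally show ?thesis
    using V by (simp add: ennreal_mult_cancel_left)
qed

lemma borel_measurable_matrix_vector_mult [measurable]:
  fixes A :: "real^'n^'m"
  shows "(\<lambda>x. A *v x) \<in> borel_measurable borel"
  by (intro borel_measurable_continuous_onI linear_continuous_on linear_linear[THEN iffD2]
      matrix_vector_mul_linear)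

text \<open>
  The scaling formula for Lebesgue measure along the coordinate axes is stated in terms of the
  abstract basis of a Euclidean space; here it is restated for diagonal matrices, the product of
  the scaling factors being the determinant.
\<close>

lemma nn_integral_lborel_diagonal_matrix:
  fixes f :: "real^'n \<Rightarrow> ennreal"
  assumes k: "\<And>i. k i \<noteq> 0" and [measurable]: "f \<in> borel_measurable borel"
  shows "(\<integral>\<^sup>+x. f x \<partial>lborel) = \<bar>det (diagonal_matrix k)\<bar> * (\<integral>\<^sup>+x. f (diagonal_matrix k *v x) \<partial>lborel)"
proof -
  define c where "c b = b \<bullet> (diagonal_matrix k *v b)" for b :: "real^'n"
  have c: "c (axis i 1) = k i" for i
    by (simp add: c_def inner_axis' diagonal_matrix_vector_mult)
  have nz: "c b \<noteq> 0" if "b \<in> Basis" for b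
    using that c k by (auto simp: Basis_vec_def)
  have T: "0 + (\<Sum>b\<in>Basis. (c b * (x \<bullet> b)) *\<^sub>R b) = diagonal_matrix k *v x" for x
  proof (rule euclidean_eqI)
    fix b :: "real^'n" assume b: "b \<in> Basis"
    then obtain i where i: "b = axis i 1"
      by (auto simp: Basis_vec_def)
    have "(\<Sum>b\<in>Basis. (c b * (x \<bullet> b)) *\<^sub>R b) \<bullet> b = c b * (x \<bullet> b)"
      using b by simp
    then show "(0 + (\<Sum>b\<in>Basis. (c b * (x \<bullet> b)) *\<^sub>R b)) \<bullet> b = (diagonal_matrix k *v x) \<bullet> b"
      by (simp add: i c inner_axis diagonal_matrix_vector_mult)
  qed
  have Basis_eq: "(Basis :: (real^'n) set) = range (\<lambda>i. axis i 1)"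
    by (auto simp: Basis_vec_def)
  have "(\<Prod>b\<in>Basis. \<bar>c b\<bar>) = (\<Prod>i\<in>UNIV. \<bar>k i\<bar>)"
    unfolding Basis_eq by (subst prod.reindex) (auto simp: inj_on_def axis_eq_axis c)
  also have "\<dots> = \<bar>det (diagonal_matrix k)\<bar>"
    by (subst det_diagonal) (auto simp: diagonal_matrix_def abs_prod)
  finally have "lborel = density (distr lborel borel ((*v) (diagonal_matrix k))) (\<lambda>_. \<bar>det (diagonal_matrix k)\<bar>)"
    using lborel_affine_euclidean[of c 0, OF nz] unfolding T by simp
  then have "(\<integral>\<^sup>+x. f x \<partial>lborel) = (\<integral>\<^sup>+x. f x \<partial>density (distr lborel borel ((*v) (diagonal_matrix k))) (\<lambda>_. \<bar>det (diagonal_matrix k)\<bar>))"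
    by simp
  then show ?thesis
    by (simp add: nn_integral_density nn_integral_distr nn_integral_cmult)
qed

text \<open>
  Composing a translation, an orthogonal map, a diagonal map and an orthogonal map. The
  determinants of the two orthogonal factors cancel.
\<close>

lemma lborel_affine_orthogonally_diagonal:
  fixes Q :: "real^'n^'n"
  assumes Q: "orthogonal_matrix Q" and k: "\<And>i. k i \<noteq> 0"
    and S: "S = Q ** diagonal_matrix k ** transpose Q"
  shows "lborel = density (distr lborel borel (\<lambda>y. m + S *v y)) (\<lambda>_. ennreal \<bar>det S\<bar>)"
proof (rule measure_eqI)
  fix X :: "(real^'n) set" assume "X \<in> sets lborel"
  then have X[measurable]: "X \<in> sets borel" by simp
  have oQ: "orthogonal_transformation ((*v) Q)" "orthogonal_transformation ((*v) (transpose Q))"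
    using Q by (auto simp: orthogonal_transformation_matrix)
  have "det Q * det Q = 1"
    using det_orthogonal_matrix[OF Q] by auto
  then have det: "det S = det (diagonal_matrix k)"
    by (simp add: S det_mul det_transpose)
  have "emeasure lborel X = (\<integral>\<^sup>+x. indicator X x \<partial>lborel)"
    by simp
  also have "\<dots> = (\<integral>\<^sup>+x. indicator X (x + m) \<partial>lborel)"
    by (subst nn_integral_lborel_translate) auto
  also have "\<dots> = (\<integral>\<^sup>+x. indicator X (Q *v x + m) \<partial>lborel)"
    by (subst nn_integral_lborel_orthogonal_transformation[OF oQ(1), of "\<lambda>x. indicator X (x + m)"]) auto
  also have "\<dots> = \<bar>det S\<bar> * (\<integral>\<^sup>+x. indicator X (Q *v (diagonal_matrix k *v x) + m) \<partial>lborel)"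
    unfolding det
    by (subst nn_integral_lborel_diagonal_matrix[of k "\<lambda>x. indicator X (Q *v x + m)"]) (use k in auto)
  also have "(\<integral>\<^sup>+x. indicator X (Q *v (diagonal_matrix k *v x) + m) \<partial>lborel) =
      (\<integral>\<^sup>+x. indicator X (Q *v (diagonal_matrix k *v (transpose Q *v x)) + m) \<partial>lborel)"
    by (subst nn_integral_lborel_orthogonal_transformation[OF oQ(2),
          of "\<lambda>x. indicator X (Q *v (diagonal_matrix k *v x) + m)"]) auto
  also have "\<dots> = (\<integral>\<^sup>+x. indicator X (m + S *v x) \<partial>lborel)"
    by (simp only: S matrix_vector_mul_assoc matrix_mul_assoc add.commute)
  also have "\<bar>det S\<bar> * \<dots> = emeasure (density (distr lborel borel (\<lambda>y. m + S *v y)) (\<lambda>_. ennreal \<bar>det S\<bar>)) X"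
  proof -
    have "(\<integral>\<^sup>+x. indicator X (m + S *v x) \<partial>lborel) = (\<integral>\<^sup>+x. indicator X x \<partial>distr lborel borel (\<lambda>y. m + S *v y))"
      by (simp add: nn_integral_distr del: nn_integral_indicator)
    then show ?thesis
      by (simp add: emeasure_density nn_integral_cmult)
  qed
  finally show "emeasure lborel X = emeasure (density (distr lborel borel (\<lambda>y. m + S *v y)) (\<lambda>_. ennreal \<bar>det S\<bar>)) X" .
qed simp

lemma has_bochner_integral_lborel_affine:
  fixes S :: "real^'n^'n" and g :: "real^'n \<Rightarrow> real"
  assumes eq: "lborel = density (distr lborel borel (\<lambda>y. m + S *v y)) (\<lambda>_. ennreal \<bar>det S\<bar>)"
    and [measurable]: "g \<in> borel_measurable borel"
    and int: "has_bochner_integral lborel (\<lambda>y. \<bar>det S\<bar> * g (m + S *v y)) I"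
  shows "has_bochner_integral lborel g I"
proof (subst eq, rule has_bochner_integral_density)
  show "has_bochner_integral (distr lborel borel (\<lambda>y. m + S *v y)) (\<lambda>x. \<bar>det S\<bar> *\<^sub>R g x) I"
    by (rule has_bochner_integral_distr) (use int in auto)
qed auto

lemma integral_lborel_orthogonal_transformation:
  fixes g :: "'a::euclidean_space \<Rightarrow> real" and T :: "'a \<Rightarrow> 'a"
  assumes T: "orthogonal_transformation T" and [measurable]: "g \<in> borel_measurable borel"
  shows "(LINT x|lborel. g (T x)) = (LINT x|lborel. g x)"
proof -
  have [measurable]: "T \<in> borel_measurable borel"
    by (intro borel_measurable_continuous_onI linear_continuous_on linear_linear[THEN iffD2]
        orthogonal_transformation_linear T)
  have "distr lborel borel T = lborel"
  proof (rule measure_eqI)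
    fix X :: "'a set" assume "X \<in> sets (distr lborel borel T)"
    then have [measurable]: "X \<in> sets borel" by simp
    have "emeasure (distr lborel borel T) X = (\<integral>\<^sup>+x. indicator X (T x) \<partial>lborel)"
      by (simp add: nn_integral_distr flip: nn_integral_indicator)
    then show "emeasure (distr lborel borel T) X = emeasure lborel X"
      by (simp add: nn_integral_lborel_orthogonal_transformation[OF T])
  qed simp
  then have "(LINT x|lborel. g x) = (LINT x|distr lborel borel T. g x)"
    by simp
  also have "\<dots> = (LINT x|lborel. g (T x))"
    by (intro integral_distr) auto
  finally show ?thesis ..
qed

section \<open>Divergence between translates of a radial density\<close>

text \<open>
  A supremum of continuous functions is lower semicontinuous, whence Borel measurable although the
  index set may be uncountable. This makes the dominating function of the
  main theorem measurable.
\<close>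

lemma borel_measurable_SUP_continuous:
  fixes g :: "'b \<Rightarrow> 'a::topological_space \<Rightarrow> ennreal"
  assumes "\<And>t. t \<in> K \<Longrightarrow> continuous_on UNIV (g t)"
  shows "(\<lambda>y. SUP t\<in>K. g t y) \<in> borel_measurable borel"
proof (rule borel_measurableI_greater)
  fix a :: ennreal
  have "{y \<in> space borel. a < (SUP t\<in>K. g t y)} = (\<Union>t\<in>K. {y. a < g t y})"
    by (auto simp: less_SUP_iff)
  also have "open \<dots>"
    by (intro open_UN ballI open_Collect_less assms continuous_intros)
  finally show "{y \<in> space borel. a < (SUP t\<in>K. g t y)} \<in> sets borel"
    by simp
qed

lemma lborel_integral_translate:
  fixes g :: "'a::euclidean_space \<Rightarrow> real"
  assumes "g \<in> borel_measurable borel"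
  shows "(LINT x|lborel. g (x + t)) = (LINT x|lborel. g x)"
proof -
  have "(LINT x|lborel. g x) = (LINT x|distr lborel borel ((+) t). g x)"
    by (simp add: lborel_distr_plus)
  also have "\<dots> = (LINT x|lborel. g (x + t))"
    by (subst integral_distr) (use assms in \<open>auto simp: add.commute\<close>)
  finally show ?thesis ..
qed

text \<open>
  The function \<open>p\<close> abbreviates \<open>pt (norm x ^ 2)\<close> in the integrability conditions, so that these read
  as statements about the density.
\<close>

locale radial_divergence =
  fixes p :: "'a::euclidean_space \<Rightarrow> real" and pt pt' f f' f'' :: "real \<Rightarrow> real"
  assumes pt_pos: "\<And>u. u \<ge> 0 \<Longrightarrow> pt u > 0"
    and pt_deriv: "\<And>u. u \<ge> 0 \<Longrightarrow> (pt has_real_derivative pt' u) (at u within {0..})"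
    and pt'_cont: "continuous_on {0..} pt'"
    and pt'_neg: "\<And>u. u \<ge> 0 \<Longrightarrow> pt' u < 0"
    and p_radial: "\<And>x. p x = pt ((norm x)\<^sup>2)"
    and f_deriv: "\<And>u. u > 0 \<Longrightarrow> (f has_real_derivative f' u) (at u)"
    and f'_deriv: "\<And>u. u > 0 \<Longrightarrow> (f' has_real_derivative f'' u) (at u)"
    and f''_pos: "\<And>u. u > 0 \<Longrightarrow> f'' u > 0"
    and f_integrable: "\<And>t. (\<integral>\<^sup>+x. ennreal (\<bar>f (p (x + t) / p x)\<bar> * p x) \<partial>lborel) < \<infinity>"
    and f'_dominated: "\<And>K. compact K \<Longrightarrow>
      (\<integral>\<^sup>+y. (SUP t\<in>K. ennreal \<bar>f' (p y / p (y + t))\<bar>)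
             * ennreal (\<bar>pt' ((norm y)\<^sup>2)\<bar> * norm y) \<partial>lborel) < \<infinity>"
begin

lemma p_pos: "p x > 0"
  by (simp add: p_radial pt_pos)

lemma pt_strict_antimono: "0 \<le> a \<Longrightarrow> a < b \<Longrightarrow> pt b < pt a"
proof (rule DERIV_neg_imp_decreasing_open[of a b pt])
  assume a: "0 \<le> a"
  show "continuous_on {a..b} pt"
    by (rule continuous_on_subset[of "{0..}"]) (use a in \<open>auto intro: DERIV_continuous_on pt_deriv\<close>)
  fix x assume "a < x"
  then have "(pt has_real_derivative pt' x) (at x)"
    using a pt_deriv[of x] at_within_interior[of x "{0..}"] by simp
  then show "\<exists>y. (pt has_real_derivative y) (at x) \<and> y < 0"
    using pt'_neg[of x] a \<open>a < x\<close> by auto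
qed

lemma f'_strict_mono: "0 < a \<Longrightarrow> a < b \<Longrightarrow> f' a < f' b"
  by (rule DERIV_pos_imp_increasing_open[of a b f'])
    (auto intro!: f''_pos exI f'_deriv[THEN DERIV_isCont] continuous_at_imp_continuous_on
      intro: f'_deriv)

lemma continuous_on_p [continuous_intros]:
  assumes "continuous_on S u"
  shows "continuous_on S (\<lambda>x. p (u x))"
  unfolding p_radial
  by (rule continuous_on_compose2[of "{0..}" pt])
    (auto intro!: continuous_intros assms DERIV_continuous_on[OF pt_deriv])

lemma continuous_on_pt' [continuous_intros]:
  assumes "continuous_on S u"
  shows "continuous_on S (\<lambda>x. pt' ((norm (u x))\<^sup>2))"
  by (rule continuous_on_compose2[OF pt'_cont]) (auto intro!: continuous_intros assms)

lemma continuous_on_f_ratio [continuous_intros]: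
  assumes "continuous_on S u" "continuous_on S v"
  shows "continuous_on S (\<lambda>x. f (p (u x) / p (v x)))"
  by (rule continuous_on_compose2[of "{0<..}" f])
    (use assms p_pos in \<open>auto intro!: continuous_intros continuous_at_imp_continuous_on f_deriv[THEN DERIV_isCont]
      simp: less_imp_neq[OF p_pos, symmetric]\<close>)

lemma continuous_on_f'_ratio [continuous_intros]:
  assumes "continuous_on S u" "continuous_on S v"
  shows "continuous_on S (\<lambda>x. f' (p (u x) / p (v x)))"
  by (rule continuous_on_compose2[of "{0<..}" f'])
    (use assms p_pos in \<open>auto intro!: continuous_intros continuous_at_imp_continuous_on f'_deriv[THEN DERIV_isCont]
      simp: less_imp_neq[OF p_pos, symmetric]\<close>)

text \<open>
  In standardized coordinates the first density is \<open>p\<close> and the second one is its translate by \<open>s\<close>.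
\<close>

definition shift_integrand :: "'a \<Rightarrow> 'a \<Rightarrow> real" where
  "shift_integrand s y = f (p (y - s) / p y) * p y"

definition shift_divergence :: "'a \<Rightarrow> real" where
  "shift_divergence s = (LINT y|lborel. shift_integrand s y)"

lemma borel_measurable_shift_integrand [measurable]: "shift_integrand s \<in> borel_measurable borel"
  unfolding shift_integrand_def[abs_def] by (intro borel_measurable_continuous_onI continuous_intros)

lemma integrable_shift_integrand: "integrable lborel (shift_integrand s)"
proof (rule integrableI_bounded)
  have "(\<integral>\<^sup>+y. ennreal (norm (shift_integrand s y)) \<partial>lborel)
      = (\<integral>\<^sup>+y. ennreal (\<bar>f (p (y + (- s)) / p y)\<bar> * p y) \<partial>lborel)"
    using p_pos by (simp add: shift_integrand_def abs_mult less_imp_le)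
  also have "\<dots> < \<infinity>"
    by (rule f_integrable)
  finally show "(\<integral>\<^sup>+y. ennreal (norm (shift_integrand s y)) \<partial>lborel) < \<infinity>" .
qed simp

lemma shift_divergence_orthogonal_transformation:
  fixes T :: "'a \<Rightarrow> 'a"
  assumes T: "orthogonal_transformation T"
  shows "shift_divergence (T s) = shift_divergence s"
proof -
  have "p (T x) = p x" for x
    using T by (simp add: p_radial orthogonal_transformation)
  moreover have "T (y - s) = T y - T s" for y
    using T by (simp add: orthogonal_transformation linear_diff)
  ultimately have "shift_integrand (T s) (T y) = shift_integrand s y" for y
    unfolding shift_integrand_def by metis
  then show ?thesis
    using integral_lborel_orthogonal_transformation[OF T, of "shift_integrand (T s)"]
    by (simp add: shift_divergence_def)
qed

text \<open>
  The derivative of \<open>shift_integrand (t e)\<close> with respect to \<open>t\<close>, evaluated at \<open>y + t e\<close> instead of \<open>y\<close>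
  (see \<open>shift_integrand_has_derivative\<close>). Only in this form does the domination hypothesis apply to
  it.
\<close>

definition slope_integrand :: "'a \<Rightarrow> real \<Rightarrow> 'a \<Rightarrow> real" where
  "slope_integrand e t y = f' (p y / p (y + t *\<^sub>R e)) * (- 2 * pt' ((norm y)\<^sup>2)) * (y \<bullet> e)"

definition slope :: "'a \<Rightarrow> real \<Rightarrow> real" where
  "slope e t = (LINT y|lborel. slope_integrand e t y)"

lemma continuous_on_slope_integrand [continuous_intros]:
  assumes "continuous_on S u" "continuous_on S v"
  shows "continuous_on S (\<lambda>x. slope_integrand e (u x) (v x))"
  unfolding slope_integrand_def by (intro continuous_intros assms)

lemma borel_measurable_slope_integrand [measurable]: "slope_integrand e t \<in> borel_measurable borel"
  by (intro borel_measurable_continuous_onI continuous_intros)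

lemma p_has_derivative: "(p has_derivative (\<lambda>h. 2 * pt' ((norm x)\<^sup>2) * (x \<bullet> h))) (at x)"
proof -
  have "((\<lambda>x. x \<bullet> x) has_derivative (\<lambda>h. 2 * (x \<bullet> h))) (at x)"
    by (rule derivative_eq_intros | rule ext | simp add: inner_commute)+
  moreover have "(pt has_derivative (\<lambda>h. pt' (x \<bullet> x) * h)) (at (x \<bullet> x) within (\<lambda>x. x \<bullet> x) ` UNIV)"
    using pt_deriv[of "x \<bullet> x"] unfolding has_field_derivative_def
    by (rule has_derivative_subset) auto
  ultimately have "((\<lambda>x. pt (x \<bullet> x)) has_derivative (\<lambda>h. pt' (x \<bullet> x) * (2 * (x \<bullet> h)))) (at x)"
    by (rule has_derivative_in_compose)
  then show ?thesis
    by (simp add: p_radial[abs_def] power2_norm_eq_inner mult_ac)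
qed

lemma shift_integrand_has_derivative:
  "((\<lambda>t. shift_integrand (t *\<^sub>R e) y) has_real_derivative slope_integrand e t (y - t *\<^sub>R e)) (at t within S)"
proof -
  let ?z = "y - t *\<^sub>R e"
  have "((\<lambda>t. y - t *\<^sub>R e) has_derivative (\<lambda>h. - (h *\<^sub>R e))) (at t within S)"
    by (auto intro!: derivative_eq_intros)
  from has_derivative_compose[OF this p_has_derivative]
  have "((\<lambda>t. p (y - t *\<^sub>R e)) has_real_derivative - 2 * pt' ((norm ?z)\<^sup>2) * (?z \<bullet> e)) (at t within S)"
    unfolding has_field_derivative_def
    by (rule has_derivative_eq_rhs) (simp add: fun_eq_iff algebra_simps)
  then have "((\<lambda>t. p (y - t *\<^sub>R e) / p y) has_real_derivative - 2 * pt' ((norm ?z)\<^sup>2) * (?z \<bullet> e) / p y) (at t within S)"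
    by (rule DERIV_cdivide)
  with f_deriv[of "p ?z / p y"] have "((\<lambda>t. f (p (y - t *\<^sub>R e) / p y)) has_real_derivative
      f' (p ?z / p y) * (- 2 * pt' ((norm ?z)\<^sup>2) * (?z \<bullet> e) / p y)) (at t within S)"
    by (intro DERIV_chain2[where g="\<lambda>t. p (y - t *\<^sub>R e) / p y"]) (auto simp: p_pos)
  from DERIV_cmult_right[OF this, of "p y"] show ?thesis
    using p_pos[of y] by (simp add: shift_integrand_def slope_integrand_def field_simps)
qed

text \<open>
  For \<open>\<bar>t\<bar> \<le> b\<close> the vectors \<open>t e\<close> lie in the compact ball of radius \<open>b\<close>, for which the domination
  hypothesis supplies the integrable bound. The bound is kept in the extended reals; that
  its integral is finite yields finite values almost everywhere, which suffices.
\<close>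

lemma slope_integrand_dominated:
  assumes e: "norm e = 1"
  obtains W where "W \<in> borel_measurable borel" "(\<integral>\<^sup>+y. W y \<partial>lborel) < \<infinity>"
    "\<And>t y. \<bar>t\<bar> \<le> b \<Longrightarrow> ennreal \<bar>slope_integrand e t y\<bar> \<le> W y"
proof
  let ?K = "cball (0::'a) b"
  define V where "V y = (SUP t\<in>?K. ennreal \<bar>f' (p y / p (y + t))\<bar>)
             * ennreal (\<bar>pt' ((norm y)\<^sup>2)\<bar> * norm y)" for y
  have "(\<lambda>y. ennreal (\<bar>pt' ((norm y)\<^sup>2)\<bar> * norm y)) \<in> borel_measurable borel"
    by (intro borel_measurable_continuous_onI continuous_on_ennreal continuous_intros)
  moreover have "(\<lambda>y. SUP t\<in>?K. ennreal \<bar>f' (p y / p (y + t))\<bar>) \<in> borel_measurable borel"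
    by (intro borel_measurable_SUP_continuous continuous_on_ennreal continuous_intros)
  ultimately have V[measurable]: "V \<in> borel_measurable borel"
    unfolding V_def by (rule borel_measurable_times_ennreal[rotated])
  then show "(\<lambda>y. 2 * V y) \<in> borel_measurable borel"
    by measurable
  have "(\<integral>\<^sup>+y. V y \<partial>lborel) < \<infinity>"
    unfolding V_def by (intro f'_dominated compact_cball)
  then show "(\<integral>\<^sup>+y. 2 * V y \<partial>lborel) < \<infinity>"
    by (simp add: nn_integral_cmult ennreal_mult_less_top)
  fix t y assume t: "\<bar>t\<bar> \<le> b"
  have "\<bar>y \<bullet> e\<bar> \<le> norm y"
    using Cauchy_Schwarz_ineq2[of y e] e by simp
  then have "\<bar>slope_integrand e t y\<bar> \<le> 2 * (\<bar>f' (p y / p (y + t *\<^sub>R e))\<bar> * (\<bar>pt' ((norm y)\<^sup>2)\<bar> * norm y))"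
    using mult_left_mono[of "\<bar>y \<bullet> e\<bar>" "norm y" "2 * (\<bar>f' (p y / p (y + t *\<^sub>R e))\<bar> * \<bar>pt' ((norm y)\<^sup>2)\<bar>)"]
    by (simp add: slope_integrand_def abs_mult mult_ac)
  then have "ennreal \<bar>slope_integrand e t y\<bar> \<le> ennreal (2 * (\<bar>f' (p y / p (y + t *\<^sub>R e))\<bar> * (\<bar>pt' ((norm y)\<^sup>2)\<bar> * norm y)))"
    by (rule ennreal_leI)
  also have "\<dots> = 2 * (ennreal \<bar>f' (p y / p (y + t *\<^sub>R e))\<bar> * ennreal (\<bar>pt' ((norm y)\<^sup>2)\<bar> * norm y))"
    by (simp add: ennreal_mult)
  also have "\<dots> \<le> 2 * V y"
    unfolding V_def using t e
    by (intro mult_left_mono mult_right_mono SUP_upper2[of "t *\<^sub>R e"]) auto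
  finally show "ennreal \<bar>slope_integrand e t y\<bar> \<le> 2 * V y" .
qed

lemma integrable_slope_integrand:
  assumes e: "norm e = 1"
  shows "integrable lborel (slope_integrand e t)"
proof -
  obtain W where W: "W \<in> borel_measurable borel" "(\<integral>\<^sup>+y. W y \<partial>lborel) < \<infinity>"
    "\<And>y. ennreal \<bar>slope_integrand e t y\<bar> \<le> W y"
    using slope_integrand_dominated[OF e, of "\<bar>t\<bar>"] by (metis order_refl)
  have "(\<integral>\<^sup>+y. ennreal (norm (slope_integrand e t y)) \<partial>lborel) \<le> (\<integral>\<^sup>+y. W y \<partial>lborel)"
    using W(3) by (intro nn_integral_mono) auto
  with W(2) show ?thesis
    by (intro integrableI_bounded) (auto simp: less_le_trans le_less_trans)
qed

lemma continuous_on_slope: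
  assumes e: "norm e = 1"
  shows "continuous_on UNIV (slope e)"
proof (rule continuous_at_imp_continuous_on, rule ballI, rule continuous_at_sequentiallyI)
  fix t and u :: "nat \<Rightarrow> real" assume u: "u \<longlonglongrightarrow> t"
  then have "Bseq u"
    by (rule convergent_imp_Bseq[OF convergentI])
  then obtain b where b: "\<And>n. \<bar>u n\<bar> \<le> b"
    unfolding Bseq_def by auto
  obtain W where W: "W \<in> borel_measurable borel" "(\<integral>\<^sup>+y. W y \<partial>lborel) < \<infinity>"
    "\<And>t y. \<bar>t\<bar> \<le> b \<Longrightarrow> ennreal \<bar>slope_integrand e t y\<bar> \<le> W y"
    using slope_integrand_dominated[OF e] by metis
  have W_fin: "AE y in lborel. W y < \<infinity>"
    using nn_integral_PInf_AE[of W lborel] W by (auto simp: less_top)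
  show "(\<lambda>n. slope e (u n)) \<longlonglongrightarrow> slope e t"
    unfolding slope_def
  proof (rule integral_dominated_convergence)
    show "integrable lborel (\<lambda>y. enn2real (W y))"
    proof (rule integrableI_bounded)
      have "(\<integral>\<^sup>+y. ennreal (norm (enn2real (W y))) \<partial>lborel) = (\<integral>\<^sup>+y. W y \<partial>lborel)"
        using W_fin by (intro nn_integral_cong_AE) auto
      then show "(\<integral>\<^sup>+y. ennreal (norm (enn2real (W y))) \<partial>lborel) < \<infinity>"
        using W(2) by simp
    qed (use W(1) in measurable)
    show "AE y in lborel. (\<lambda>n. slope_integrand e (u n) y) \<longlonglongrightarrow> slope_integrand e t y"
    proof (rule AE_I2)
      fix y
      have "isCont (\<lambda>t. slope_integrand e t y) t"
        using continuous_on_slope_integrand[of UNIV "\<lambda>t. t" "\<lambda>_. y" e]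
        by (auto simp: continuous_on_eq_continuous_at continuous_on_id)
      then show "(\<lambda>n. slope_integrand e (u n) y) \<longlonglongrightarrow> slope_integrand e t y"
        using u by (rule isCont_tendsto_compose)
    qed
    show "AE y in lborel. norm (slope_integrand e (u n) y) \<le> enn2real (W y)" for n
      using W_fin
    proof eventually_elim
      case (elim y)
      then show ?case
        using W(3)[OF b, of n y] by (cases "W y") (auto simp: ennreal_le_iff)
    qed
  qed auto
qed

section \<open>Differentiating the divergence along a line\<close>

text \<open>
  The increment of the integrand is the integral over \<open>t\<close> of its derivative
  \<open>slope_integrand e t (y - t e)\<close>. Fubini's theorem permits integration over \<open>y\<close> first, where for each \<open>t\<close> the shift
  by \<open>t e\<close> disappears by translation invariance; the same translation, done on absolute values,
  verifies the integrability that Fubini requires.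
\<close>

lemma shift_divergence_increment:
  assumes e: "norm e = 1" and b: "0 \<le> b"
  shows "shift_divergence (b *\<^sub>R e) - shift_divergence 0 = (LINT t|lborel. indicator {0..b} t *\<^sub>R slope e t)"
proof -
  define F where "F t y = indicator {0..b} t *\<^sub>R slope_integrand e t (y - t *\<^sub>R e)" for t y
  \<comment> \<open>Continuity in both variables jointly gives measurability on the product space.\<close>
  have "(\<lambda>z. slope_integrand e (fst z) (snd z - fst z *\<^sub>R e)) \<in> borel_measurable borel"
    by (intro borel_measurable_continuous_onI continuous_intros)
  then have "(\<lambda>z. slope_integrand e (fst z) (snd z - fst z *\<^sub>R e)) \<in> borel_measurable (borel \<Otimes>\<^sub>M borel)"
    by (simp add: borel_prod)
  then have F[measurable]: "case_prod F \<in> borel_measurable (borel \<Otimes>\<^sub>M borel)"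
    unfolding F_def case_prod_beta by (intro borel_measurable_scaleR) measurable
  obtain W where W: "W \<in> borel_measurable borel" "(\<integral>\<^sup>+y. W y \<partial>lborel) < \<infinity>"
    "\<And>t y. \<bar>t\<bar> \<le> b \<Longrightarrow> ennreal \<bar>slope_integrand e t y\<bar> \<le> W y"
    using slope_integrand_dominated[OF e] by metis
  have inner: "(\<integral>\<^sup>+y. ennreal (norm (F t y)) \<partial>lborel) \<le> (\<integral>\<^sup>+y. W y \<partial>lborel) * indicator {0..b} t" for t
  proof (cases "t \<in> {0..b}")
    case True
    have "(\<integral>\<^sup>+y. ennreal (norm (F t y)) \<partial>lborel)
        = (\<integral>\<^sup>+y. ennreal \<bar>slope_integrand e t (y + (- t *\<^sub>R e))\<bar> \<partial>lborel)"
      using True by (simp add: F_def)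
    also have "\<dots> = (\<integral>\<^sup>+y. ennreal \<bar>slope_integrand e t y\<bar> \<partial>lborel)"
      by (rule nn_integral_lborel_translate) measurable
    also have "\<dots> \<le> (\<integral>\<^sup>+y. W y \<partial>lborel)"
      using True by (intro nn_integral_mono W(3)) auto
    finally show ?thesis
      using True by simp
  qed (simp add: F_def)
  have int_F: "integrable (lborel \<Otimes>\<^sub>M lborel) (case_prod F)"
  proof (rule integrableI_bounded)
    have "(\<integral>\<^sup>+z. ennreal (norm (case_prod F z)) \<partial>(lborel \<Otimes>\<^sub>M lborel))
        = (\<integral>\<^sup>+t. \<integral>\<^sup>+y. ennreal (norm (F t y)) \<partial>lborel \<partial>lborel)"
      by (subst lborel.nn_integral_fst[symmetric]) auto
    also have "\<dots> \<le> (\<integral>\<^sup>+t. (\<integral>\<^sup>+y. W y \<partial>lborel) * indicator {0..b} t \<partial>lborel)"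
      by (intro nn_integral_mono inner)
    also have "\<dots> = (\<integral>\<^sup>+y. W y \<partial>lborel) * ennreal b"
      using b by (simp add: nn_integral_cmult)
    also have "\<dots> < \<infinity>"
      using W(2) by (simp add: ennreal_mult_less_top)
    finally show "(\<integral>\<^sup>+z. ennreal (norm (case_prod F z)) \<partial>(lborel \<Otimes>\<^sub>M lborel)) < \<infinity>" .
  qed auto
  have "(LINT t|lborel. F t y) = shift_integrand (b *\<^sub>R e) y - shift_integrand 0 y" for y
    unfolding F_def
    by (subst integral_FTC_atLeastAtMost[OF b, of "\<lambda>t. shift_integrand (t *\<^sub>R e) y"])
      (auto intro!: continuous_intros shift_integrand_has_derivative
        simp flip: has_real_derivative_iff_has_vector_derivative)
  then have "shift_divergence (b *\<^sub>R e) - shift_divergence 0 = (LINT y|lborel. LINT t|lborel. F t y)"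
    by (simp add: shift_divergence_def integrable_shift_integrand)
  also have "\<dots> = (LINT t|lborel. LINT y|lborel. F t y)"
    by (rule lborel_pair.Fubini_integral[OF int_F])
  also have "\<dots> = (LINT t|lborel. indicator {0..b} t *\<^sub>R slope e t)"
  proof (rule Bochner_Integration.integral_cong[OF refl])
    fix t
    show "(LINT y|lborel. F t y) = indicator {0..b} t *\<^sub>R slope e t"
      using lborel_integral_translate[of "slope_integrand e t" "- t *\<^sub>R e"]
      by (simp add: F_def slope_def)
  qed
  finally show ?thesis .
qed

lemma shift_divergence_has_derivative:
  assumes e: "norm e = 1" and t: "0 \<le> t"
  shows "((\<lambda>t. shift_divergence (t *\<^sub>R e)) has_real_derivative slope e t) (at t within {0..})"
proof -
  define G where "G t = integral {0..t} (slope e)" for t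
  have cont: "continuous_on S (slope e)" for S
    using continuous_on_subset[OF continuous_on_slope[OF e]] by simp
  have G: "(G has_real_derivative slope e s) (at s within {0..b})" if "0 \<le> s" "s \<le> b" for s b
    unfolding G_def using that by (intro integral_has_real_derivative cont) auto
  have eq: "shift_divergence (b *\<^sub>R e) = shift_divergence 0 + G b" if "0 \<le> b" for b
  proof -
    have "shift_divergence (b *\<^sub>R e) - shift_divergence 0 = G b - G 0"
      unfolding shift_divergence_increment[OF e that]
      using that by (intro integral_FTC_atLeastAtMost cont)
        (auto intro: G simp flip: has_real_derivative_iff_has_vector_derivative)
    then show ?thesis
      by (simp add: G_def)
  qed
  \<comment> \<open>Only an interval reaching beyond \<^term>\<open>t\<close> yields the derivative along the whole half-line.\<close>
  have "(G has_real_derivative slope e t) (at t within {0..t + 1})"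
    using t by (intro G) auto
  moreover have "at t within {0..t + 1} = at t within {0..}"
    using t by (intro at_within_nhd[of _ "{..<t + 1}"]) auto
  ultimately have "((\<lambda>t. shift_divergence 0 + G t) has_real_derivative slope e t) (at t within {0..})"
    by (auto intro!: derivative_eq_intros)
  then show ?thesis
    by (rule has_field_derivative_transform_within[of _ _ _ _ 1]) (use t eq in auto)
qed

text \<open>
  The integrand of the slope has no sign of its own; its even part \<open>q / 2\<close> does. Radial symmetry gives
  \<open>p (- y + t e) = p (y - t e)\<close>, so \<open>q\<close> compares \<open>f'\<close> at the two ratios belonging to \<open>y + t e\<close> and
  \<open>y - t e\<close>, and monotonicity of \<open>f'\<close> and of the radial profile orders them according to the sign of
  \<open>y \<bullet> e\<close>.
\<close>

lemma slope_pos: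
  assumes e: "norm e = 1" and t: "0 < t"
  shows "slope e t > 0"
proof -
  define q where "q y = slope_integrand e t y + slope_integrand e t (- y)" for y
  have q_eq: "q y = (- 2 * pt' ((norm y)\<^sup>2)) * ((y \<bullet> e) * (f' (p y / p (y + t *\<^sub>R e)) - f' (p y / p (y - t *\<^sub>R e))))" for y
  proof -
    have "p (- y) = p y" "p (- y + t *\<^sub>R e) = p (y - t *\<^sub>R e)"
      using norm_minus_commute[of y "t *\<^sub>R e"] by (simp_all add: p_radial)
    then show ?thesis
      by (simp add: q_def slope_integrand_def algebra_simps)
  qed
  have norm_diff: "(norm (y + t *\<^sub>R e))\<^sup>2 - (norm (y - t *\<^sub>R e))\<^sup>2 = 4 * t * (y \<bullet> e)" for y
    by (simp add: power2_norm_eq_inner inner_simps inner_commute algebra_simps)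
  have ratio_less: "f' (p y / p z) < f' (p y / p z')" if "(norm z')\<^sup>2 > (norm z)\<^sup>2" for y z z'
    using that p_pos pt_strict_antimono[of "(norm z)\<^sup>2" "(norm z')\<^sup>2"]
    by (intro f'_strict_mono divide_strict_left_mono) (auto simp: p_radial[symmetric])
  have q_pos: "q y > 0" if "y \<bullet> e \<noteq> 0" for y
  proof -
    have "(y \<bullet> e) * (f' (p y / p (y + t *\<^sub>R e)) - f' (p y / p (y - t *\<^sub>R e))) > 0"
    proof (cases "y \<bullet> e > 0")
      case True
      then have "4 * t * (y \<bullet> e) > 0"
        using t by simp
      then show ?thesis
        using True norm_diff[of y] ratio_less[of "y - t *\<^sub>R e" "y + t *\<^sub>R e"]
        by (intro mult_pos_pos) auto
    next
      case False
      then have "y \<bullet> e < 0" and "4 * t * (y \<bullet> e) < 0"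
        using t that by (auto simp: mult_pos_neg)
      then show ?thesis
        using norm_diff[of y] ratio_less[of "y + t *\<^sub>R e" "y - t *\<^sub>R e"]
        by (intro mult_neg_neg) auto
    qed
    moreover have "- 2 * pt' ((norm y)\<^sup>2) > 0"
      using pt'_neg[of "(norm y)\<^sup>2"] by simp
    ultimately show ?thesis
      unfolding q_eq by (rule mult_pos_pos[rotated])
  qed
  have q_nonneg: "q y \<ge> 0" for y
    using q_pos[of y] by (cases "y \<bullet> e = 0") (auto simp: q_eq)
  have orth: "orthogonal_transformation (uminus :: 'a \<Rightarrow> 'a)"
    by (auto simp: orthogonal_transformation_def linear_uminus)
  have int: "integrable lborel (slope_integrand e t)" "integrable lborel (\<lambda>y. slope_integrand e t (- y))"
  proof -
    show 1: "integrable lborel (slope_integrand e t)"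
      by (rule integrable_slope_integrand[OF e])
    have "(\<integral>\<^sup>+y. ennreal (norm (slope_integrand e t (- y))) \<partial>lborel) = (\<integral>\<^sup>+y. ennreal (norm (slope_integrand e t y)) \<partial>lborel)"
      by (rule nn_integral_lborel_orthogonal_transformation[OF orth]) measurable
    then show "integrable lborel (\<lambda>y. slope_integrand e t (- y))"
      using 1 by (auto simp: integrable_iff_bounded)
  qed
  have int_q: "integrable lborel q"
    unfolding q_def using int by simp
  have "2 * slope e t = (LINT y|lborel. q y)"
    unfolding q_def using int integral_lborel_orthogonal_transformation[OF orth, of "slope_integrand e t"]
    by (simp add: slope_def)
  moreover have "(LINT y|lborel. q y) \<noteq> 0"
  proof
    assume "(LINT y|lborel. q y) = 0"
    then have "AE y in lborel. q y = 0"
      using integral_nonneg_eq_0_iff_AE[OF int_q] q_nonneg by simp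
    then have "AE y in lborel. \<not> (y \<bullet> e \<noteq> 0)"
      by (rule eventually_mono) (use q_pos in force)
    then have "{y. y \<bullet> e \<noteq> 0} \<in> null_sets lborel"
      by (subst (asm) AE_iff_null) auto
    then have "negligible {y. y \<bullet> e \<noteq> 0}"
      by (auto simp: negligible_iff_null_sets null_sets_completionI)
    moreover have "open {y. y \<bullet> e \<noteq> 0}"
      by (intro open_Collect_neq continuous_intros)
    moreover have "e \<in> {y. y \<bullet> e \<noteq> 0}"
      using e by (auto simp: norm_eq_1)
    ultimately show False
      using open_not_negligible by blast
  qed
  moreover have "(LINT y|lborel. q y) \<ge> 0"
    using q_nonneg by simp
  ultimately show ?thesis by simp
qed

text \<open>
  The derivative of \<open>t \<mapsto> J (t e)\<close> is available on the whole closed half-line, but the square root is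
  not differentiable at \<open>0\<close>; there the substitution \<open>t = sqrt r\<close> yields continuity only.
\<close>

lemma radial_profile:
  assumes e: "norm e = 1"
  defines "h \<equiv> \<lambda>r. shift_divergence (sqrt r *\<^sub>R e)"
  shows "strict_mono_on {0..} h" "continuous_on {0..} h" "h differentiable_on {0<..}"
proof -
  define H where "H t = shift_divergence (t *\<^sub>R e)" for t
  have H: "(H has_real_derivative slope e t) (at t within {0..})" if "0 \<le> t" for t
    unfolding H_def using shift_divergence_has_derivative[OF e that] .
  have H': "(H has_real_derivative slope e t) (at t)" if "0 < t" for t
    using H[of t] at_within_interior[of t "{0..}"] that by simp
  have contH: "continuous_on {0..} H"
    using H by (intro DERIV_continuous_on) auto
  have h: "h = (\<lambda>r. H (sqrt r))"
    by (simp add: h_def H_def)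
  have "H a < H b" if "0 \<le> a" "a < b" for a b
  proof (rule DERIV_pos_imp_increasing_open[OF that(2)])
    show "continuous_on {a..b} H"
      by (rule continuous_on_subset[OF contH]) (use that in auto)
    show "\<exists>y. (H has_real_derivative y) (at x) \<and> y > 0" if "a < x" for x
      using H'[of x] slope_pos[OF e, of x] that \<open>0 \<le> a\<close> by auto
  qed
  then show "strict_mono_on {0..} h"
    by (auto simp: strict_mono_on_def h)
  show "continuous_on {0..} h"
    unfolding h by (rule continuous_on_compose2[OF contH]) (auto intro!: continuous_intros)
  have "\<exists>D. (h has_real_derivative D) (at r)" if "0 < r" for r
    unfolding h using that
    by (intro exI) (rule DERIV_chain2[OF H' DERIV_real_sqrt], auto)
  then show "h differentiable_on {0<..}"
    by (auto simp: differentiable_on_def real_differentiable_def intro: has_field_derivative_at_within)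
qed

end

section \<open>The divergence as a function of the Mahalanobis distance\<close>

theorem theorem1:
  fixes p :: "real^'n \<Rightarrow> real"
    and pt pt' f f' f'' :: "real \<Rightarrow> real"
  assumes p_pos: "\<And>x. p x > 0"
    and p_density: "has_bochner_integral lborel p 1"
    and pt_pos: "\<And>u. u \<ge> 0 \<Longrightarrow> pt u > 0"
    and pt_deriv: "\<And>u. u \<ge> 0 \<Longrightarrow> (pt has_real_derivative pt' u) (at u within {0..})"
    and pt'_cont: "continuous_on {0..} pt'"
    and pt'_neg: "\<And>u. u \<ge> 0 \<Longrightarrow> pt' u < 0"
    and p_radial: "\<And>x. p x = pt ((norm x)\<^sup>2)"
    and f_deriv: "\<And>u. u > 0 \<Longrightarrow> (f has_real_derivative f' u) (at u)"
    and f'_deriv: "\<And>u. u > 0 \<Longrightarrow> (f' has_real_derivative f'' u) (at u)"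
    and f''_cont: "continuous_on {0<..} f''"
    and f_one: "f 1 = 0"
    and f''_pos: "\<And>u. u > 0 \<Longrightarrow> f'' u > 0"
    and f_integrable: "\<And>t :: real^'n.
      (\<integral>\<^sup>+x. ennreal (\<bar>f (pt ((norm (x + t))\<^sup>2) / pt ((norm x)\<^sup>2))\<bar> * pt ((norm x)\<^sup>2)) \<partial>lborel) < \<infinity>"
    and f'_dominated: "\<And>K :: (real^'n) set. compact K \<Longrightarrow>
      (\<integral>\<^sup>+y. (SUP t\<in>K. ennreal \<bar>f' (pt ((norm y)\<^sup>2) / pt ((norm (y + t))\<^sup>2))\<bar>)
             * ennreal (\<bar>pt' ((norm y)\<^sup>2)\<bar> * norm y) \<partial>lborel) < \<infinity>"
  shows "\<exists>h :: real \<Rightarrow> real.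
    strict_mono_on {0..} h \<and> continuous_on {0..} h \<and> h differentiable_on {0<..} \<and>
    (\<forall>\<Sigma> :: real^'n^'n. sym_pos_def \<Sigma> \<longrightarrow>
      (\<forall>\<mu>1 \<mu>2.
        integrable lborel
          (f_div_integrand f (loc_scale_density p \<mu>1 \<Sigma>) (loc_scale_density p \<mu>2 \<Sigma>)) \<and>
        f_divergence f (loc_scale_density p \<mu>1 \<Sigma>) (loc_scale_density p \<mu>2 \<Sigma>)
          = h (mahalanobis_sq \<Sigma> \<mu>1 \<mu>2)))"
proof -
  interpret radial_divergence p pt pt' f f' f''
    by unfold_locales (use assms in \<open>auto simp: p_radial\<close>)
  define e :: "real^'n" where "e = axis undefined 1"
  have e: "norm e = 1"
    by (simp add: e_def norm_axis_1)
  define h where "h r = shift_divergence (sqrt r *\<^sub>R e)" for r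
  have "has_bochner_integral lborel
      (f_div_integrand f (loc_scale_density p \<mu>1 \<Sigma>) (loc_scale_density p \<mu>2 \<Sigma>)) (h (mahalanobis_sq \<Sigma> \<mu>1 \<mu>2))"
    if spd: "sym_pos_def \<Sigma>" for \<Sigma> :: "real^'n^'n" and \<mu>1 \<mu>2
  proof -
    define S where "S = spd_sqrt \<Sigma>"
    define R where "R = matrix_inv S"
    define s where "s = R *v (\<mu>2 - \<mu>1)"
    obtain Q k where Q: "orthogonal_matrix Q" "\<And>i. k i > 0" "S = Q ** diagonal_matrix k ** transpose Q"
      and S: "sym_pos_def S" "S ** S = \<Sigma>"
      using spd_sqrt_diagonalization[OF spd] unfolding S_def by metis
    have k: "k i \<noteq> 0" for i
      using Q(2)[of i] by simp
    have RS: "R ** S = mat 1"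
      unfolding R_def using matrix_inv_mult(2) sym_pos_def_invertible[OF S(1)] .
    have det: "sqrt (det \<Sigma>) = \<bar>det S\<bar>" "det S \<noteq> 0"
      using sym_pos_def_invertible[OF S(1)] by (auto simp: S(2)[symmetric] det_mul invertible_det_nz)
    let ?g = "f_div_integrand f (loc_scale_density p \<mu>1 \<Sigma>) (loc_scale_density p \<mu>2 \<Sigma>)"
    have g: "?g x = 1 / \<bar>det S\<bar> * shift_integrand s (R *v (x - \<mu>1))" for x
    proof -
      have "R *v (x - \<mu>1) - s = R *v (x - \<mu>2)"
        by (simp add: s_def matrix_vector_mult_diff_distrib)
      then show ?thesis
        using det(2) by (simp add: f_div_integrand_def loc_scale_density_def shift_integrand_def det(1)
            S_def[symmetric] R_def[symmetric])
    qed
    have "has_bochner_integral lborel ?g (shift_divergence s)"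
    proof (rule has_bochner_integral_lborel_affine[OF lborel_affine_orthogonally_diagonal[OF Q(1) k Q(3), of \<mu>1]])
      show "?g \<in> borel_measurable borel"
        unfolding g[abs_def] by measurable
      have "\<bar>det S\<bar> * ?g (\<mu>1 + S *v y) = shift_integrand s y" for y
        using det(2) by (simp add: g matrix_vector_mul_assoc RS)
      then show "has_bochner_integral lborel (\<lambda>y. \<bar>det S\<bar> * ?g (\<mu>1 + S *v y)) (shift_divergence s)"
        using has_bochner_integral_integrable[OF integrable_shift_integrand[of s]]
        by (simp add: shift_divergence_def)
    qed
    moreover have "shift_divergence s = h (mahalanobis_sq \<Sigma> \<mu>1 \<mu>2)"
      unfolding h_def mahalanobis_sq_eq_norm[OF spd] S_def[symmetric] R_def[symmetric] s_def[symmetric]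
    proof -
      have "norm s = norm (norm s *\<^sub>R e)"
        by (simp add: e)
      then obtain T where "orthogonal_transformation T" "T s = norm s *\<^sub>R e"
        by (rule orthogonal_transformation_exists)
      then show "shift_divergence s = shift_divergence (sqrt ((norm s)\<^sup>2) *\<^sub>R e)"
        using shift_divergence_orthogonal_transformation[of T s] by simp
    qed
    ultimately show ?thesis by simp
  qed
  then show ?thesis
    using radial_profile[OF e] unfolding h_def[abs_def, symmetric]
    by (intro exI[of _ h]) (auto simp: f_divergence_def has_bochner_integral_iff)
qed

end
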